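(* Let $\delta^*$ be the optimal value of the mixed-integer conic program (P) given in the context, under the standing assumptions given in the context, and let $\boldsymbol{\theta}\sim\mathcal{N}(\bar{\boldsymbol{\theta}},V_{\boldsymbol{\theta}})$ be a multivariate Gaussian random vector in $\mathbb{R}^{n_\theta}$ with density $p$. Let $F_{n_\theta}$ be the cumulative distribution function of the $\chi$-squared distribution with $n_\theta$ degrees of freedom, $F_{n_\theta}(\delta)=\gamma(\tfrac{n_\theta}{2},\tfrac{\delta}{2})/\Gamma(\tfrac{n_\theta}{2})$ for $\delta\ge 0$ (with $\gamma$ the lower incomplete gamma function and $\Gamma$ the gamma function), and define the confidence level $\alpha^*:=F_{n_\theta}(\delta^* )$. Let $T_{ellip}(\delta^* )=\{\boldsymbol{\theta} : (\boldsymbol{\theta}-\bar{\boldsymbol{\theta}})^T V_{\boldsymbol{\theta}}^{-1}(\boldsymbol{\theta}-\bar{\boldsymbol{\theta}})\le\delta^*\}$, and let $SF:=\int_{\Theta}p(\boldsymbol{\theta})\,d\boldsymbol{\theta}$ with $\Theta=\{\boldsymbol{\theta} : \psi(\boldsymbol{\theta})\le 0\}$ be the stochastic flexibility index. Then: (i) $\alpha^*=\mathbb{P}(\boldsymbol{\theta}\in T_{ellip}(\delta^* ))$; (ii) $\alpha^*$ is a lower bound for the stochastic flexibility index: $\alpha^*\le SF$; (iii) $\delta^*$ is the critical value (quantile) of the $\chi$-squared distribution with $n_\theta$ degrees of freedom associated with confidence level $\alpha^*$, i.e. $\delta^*=F_{n_\theta}^{-1}(\alpha^* )$, where $F_{n_\theta}^{-1}$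 is the inverse of $F_{n_\theta}:[0,\infty)\to[0,1)$.
   Context: Setting. $J$ is a finite index set; $f_j:\mathbb{R}^{n_z}\times\mathbb{R}^{n_\theta}\to\mathbb{R}$, $j\in J$, are the system constraint functions $f_j(\mathbf{z},\boldsymbol{\theta})$, where $\mathbf{z}\in\mathbb{R}^{n_z}$ are recourse variables and $\boldsymbol{\theta}\in\mathbb{R}^{n_\theta}$ are uncertain parameters. The vector $\bar{\boldsymbol{\theta}}\in\mathbb{R}^{n_\theta}$ is the mean and $V_{\boldsymbol{\theta}}\in\mathbb{R}^{n_\theta\times n_\theta}$ is the covariance matrix, assumed symmetric positive definite. The feasibility function is $$\psi(\boldsymbol{\theta}):=\min_{\mathbf{z}\in\mathbb{R}^{n_z}}\ \max_{j\in J}\ f_j(\mathbf{z},\boldsymbol{\theta}).$$ For $\delta\ge 0$ let $T_{ellip}(\delta)=\{\boldsymbol{\theta} : (\boldsymbol{\theta}-\bar{\boldsymbol{\theta}})^T V_{\boldsymbol{\theta}}^{-1}(\boldsymbol{\theta}-\bar{\boldsymbol{\theta}})\le\delta\}$. The flexibility index problem is: maximize $\delta\in\mathbb{R}_+$ subject to $\max_{\boldsymbol{\theta}\in T_{ellip}(\delta)}\psi(\boldsymbol{\theta})\le 0$. Problem (P) is: minimize $\delta$ over $\delta\in\mathbb{R}_+$, $\mathbf{z}\in\mathbb{R}^{n_z}$, $\boldsymbol{\theta}\in\mathbb{R}^{n_\theta}$, and $\lambda_j,s_j,y_j$ ($j\in J$), subject to - $f_j(\mathbf{z},\boldsymbol{\theta})+s_j=0$,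 $j\in J$; - $\sum_{j\in J}\lambda_j=1$; - $\sum_{j\in J}\lambda_j\,\frac{\partial f_j(\mathbf{z},\boldsymbol{\theta})}{\partial\mathbf{z}}=0$; - $s_j\le U(1-y_j)$, $j\in J$; - $\lambda_j\le y_j$, $j\in J$; - $\sum_{j\in J}y_j=n_z+1$; - $(\boldsymbol{\theta}-\bar{\boldsymbol{\theta}})^T V_{\boldsymbol{\theta}}^{-1}(\boldsymbol{\theta}-\bar{\boldsymbol{\theta}})\le\delta$; - $\lambda_j\ge 0$, $s_j\ge 0$, $y_j\in\{0,1\}$, $j\in J$. Standing assumptions. (1) Each $f_j$ is continuous in $(\mathbf{z},\boldsymbol{\theta})$, and differentiable and convex in $\mathbf{z}$ (so that the first-order KKT conditions of the problem $\min_{\mathbf{z},u} u$ s.t. $f_j(\mathbf{z},\boldsymbol{\theta})\le u$, $j\in J$, are necessary and sufficient for optimality); the minimum defining $\psi(\boldsymbol{\theta})$ is attained for every $\boldsymbol{\theta}$, and $\psi$ is continuous. (2) At every $(\mathbf{z},\boldsymbol{\theta})$, any $n_z$ of the gradients $\frac{\partial f_j(\mathbf{z},\boldsymbol{\theta})}{\partial\mathbf{z}}$, $j\in J$, are linearly independent (this is what justifies the constraint $\sum_j y_j=n_z+1$). (3) $U$ is a suitable upper bound for the slacks $s_j$: it is large enough that replacing the constraints $s_j\le U(1-y_j)$ by the implications $y_j=1\Rightarrow s_j=0$ does not change the set of optimal solutions of (P). (4) The flexibility index problem has a (finite, attained) solution; in particular it is feasible. Problem (P) has an optimal solution. *)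

theory Defs
  imports "HOL-Probability.Probability"
begin

definition positive_definite :: "real ^ 'n ^ 'n \<Rightarrow> bool" where
  "positive_definite V \<longleftrightarrow> (\<forall>x. x \<noteq> 0 \<longrightarrow> 0 < x \<bullet> (V *v x))"

definition mahalanobis :: "real ^ 'n \<Rightarrow> real ^ 'n ^ 'n \<Rightarrow> real ^ 'n \<Rightarrow> real" where
  "mahalanobis \<mu> V \<theta> = (\<theta> - \<mu>) \<bullet> (matrix_inv V *v (\<theta> - \<mu>))"

definition T_ellip :: "real ^ 'n \<Rightarrow> real ^ 'n ^ 'n \<Rightarrow> real \<Rightarrow> (real ^ 'n) set" where
  "T_ellip \<mu> V \<delta> = {\<theta>. mahalanobis \<mu> V \<theta> \<le> \<delta>}"

definition gaussian_density :: "real ^ 'n \<Rightarrow> real ^ 'n ^ 'n \<Rightarrow> real ^ 'n \<Rightarrow> real" where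
  "gaussian_density \<mu> V \<theta> =
     exp (- mahalanobis \<mu> V \<theta> / 2) / sqrt ((2 * pi) ^ CARD('n) * det V)"

definition lower_incomplete_Gamma :: "real \<Rightarrow> real \<Rightarrow> real" where
  "lower_incomplete_Gamma a x = (LBINT t:{0..x}. t powr (a - 1) * exp (- t))"

text \<open>For negative arguments the range of integration is empty, so the value is 0, as it should be
  for a distribution function on the whole real line.\<close>

definition chi_square_cdf :: "nat \<Rightarrow> real \<Rightarrow> real" where
  "chi_square_cdf n \<delta> = lower_incomplete_Gamma (real n / 2) (\<delta> / 2) / Gamma (real n / 2)"

definition chi_square_density :: "nat \<Rightarrow> real \<Rightarrow> real" where
  "chi_square_density n x =
     (if x \<le> 0 then 0
      else x powr (real n / 2 - 1) * exp (- x / 2) / (2 powr (real n / 2) * Gamma (real n / 2)))"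

lemma chi_square_cdf_eq_cdf:
  assumes "0 < n"
  shows "cdf (density lborel (\<lambda>x. ennreal (chi_square_density n x))) \<delta> = chi_square_cdf n \<delta>"
proof -
  define a where "a = real n / 2"
  have a: "a > 0" using assms by (simp add: a_def)
  have G: "Gamma a > 0" using a by (rule Gamma_real_pos)
  have [measurable]: "chi_square_density n \<in> borel_measurable borel"
    unfolding chi_square_density_def by measurable
  have nonneg: "chi_square_density n x \<ge> 0" for x
    using G by (auto simp: chi_square_density_def a_def)
  have "cdf (density lborel (\<lambda>x. ennreal (chi_square_density n x))) \<delta> =
        enn2real (\<integral>\<^sup>+ x. ennreal (chi_square_density n x * indicator {..\<delta>} x) \<partial>lborel)"
    unfolding cdf_def measure_def
    by (subst emeasure_density)
       (auto intro!: arg_cong[where f = enn2real] nn_integral_cong simp: indicator_def)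
  also have "\<dots> = (LINT x|lborel. chi_square_density n x * indicator {..\<delta>} x)"
    by (rule integral_eq_nn_integral[symmetric]) (auto simp: nonneg)
  also have "\<dots> = 2 * (LINT x|lborel. chi_square_density n (2 * x) * indicator {..\<delta>} (2 * x))"
    using lborel_integral_real_affine[of 2 "\<lambda>x. chi_square_density n x * indicator {..\<delta>} x" 0]
    by simp
  also have "(\<lambda>x. chi_square_density n (2 * x) * indicator {..\<delta>} (2 * x)) =
      (\<lambda>x. (indicator {0..\<delta> / 2} x *\<^sub>R (x powr (a - 1) * exp (- x))) / (2 * Gamma a))"
  proof
    fix x :: real
    have "(2 * x) powr (a - 1) = x powr (a - 1) * 2 powr a / 2" if "x > 0"
      using that by (simp add: powr_mult powr_diff mult.commute)
    then show "chi_square_density n (2 * x) * indicator {..\<delta>} (2 * x) =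
        (indicator {0..\<delta> / 2} x *\<^sub>R (x powr (a - 1) * exp (- x))) / (2 * Gamma a)"
      using G by (auto simp: chi_square_density_def indicator_def a_def field_simps)
  qed
  also have "2 * (LINT x|lborel. (indicator {0..\<delta> / 2} x *\<^sub>R (x powr (a - 1) * exp (- x))) / (2 * Gamma a)) =
      chi_square_cdf n \<delta>"
    by (simp add: chi_square_cdf_def lower_incomplete_Gamma_def set_lebesgue_integral_def a_def)
  finally show ?thesis .
qed

text \<open>The infimum over \<open>z\<close> is a minimum under the attainment hypothesis made wherever \<open>\<psi>\<close> is used.\<close>

definition feasibility_fun ::
    "('j::finite \<Rightarrow> real ^ 'z \<Rightarrow> real ^ 'n \<Rightarrow> real) \<Rightarrow> real ^ 'n \<Rightarrow> real" where
  "feasibility_fun f \<theta> = (INF z. MAX j. f j z \<theta>)"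

text \<open>For continuous \<open>\<psi>\<close> and positive definite \<open>V\<close> the supremum is a maximum, the ellipsoid being
  compact and, for \<open>\<delta> \<ge> 0\<close>, nonempty.\<close>

definition flexibility_feasible ::
    "('j::finite \<Rightarrow> real ^ 'z \<Rightarrow> real ^ 'n \<Rightarrow> real) \<Rightarrow> real ^ 'n \<Rightarrow> real ^ 'n ^ 'n \<Rightarrow> real \<Rightarrow> bool" where
  "flexibility_feasible f \<mu> V \<delta> \<longleftrightarrow>
     0 \<le> \<delta> \<and> (SUP \<theta> \<in> T_ellip \<mu> V \<delta>. feasibility_fun f \<theta>) \<le> 0"

definition gradient :: "('a::real_inner \<Rightarrow> real) \<Rightarrow> 'a \<Rightarrow> 'a" where
  "gradient g x = (THE D. GDERIV g x :> D)"

text \<open>The parameter \<open>C\<close> is the constraint linking a slack \<open>s\<^sub>j\<close> to its binary variable \<open>y\<^sub>j\<close>;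
  the decision variables are \<open>(\<delta>, z, \<theta>, \<lambda>, s, y)\<close>.\<close>

type_synonym ('j, 'z, 'n) decision =
  "real \<times> (real ^ 'z) \<times> (real ^ 'n) \<times> ('j \<Rightarrow> real) \<times> ('j \<Rightarrow> real) \<times> ('j \<Rightarrow> real)"

definition program_feasible ::
    "(real \<Rightarrow> real \<Rightarrow> bool) \<Rightarrow> ('j::finite \<Rightarrow> real ^ 'z \<Rightarrow> real ^ 'n \<Rightarrow> real) \<Rightarrow>
     real ^ 'n \<Rightarrow> real ^ 'n ^ 'n \<Rightarrow> ('j, 'z, 'n) decision set" where
  "program_feasible C f \<mu> V = {(\<delta>, z, \<theta>, l, s, y).
     0 \<le> \<delta> \<and>
     (\<forall>j. f j z \<theta> + s j = 0) \<and>
     (\<Sum>j\<in>UNIV. l j) = 1 \<and>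
     (\<Sum>j\<in>UNIV. l j *\<^sub>R gradient (\<lambda>w. f j w \<theta>) z) = 0 \<and>
     (\<forall>j. C (s j) (y j)) \<and>
     (\<forall>j. l j \<le> y j) \<and>
     (\<Sum>j\<in>UNIV. y j) = real CARD('z) + 1 \<and>
     mahalanobis \<mu> V \<theta> \<le> \<delta> \<and>
     (\<forall>j. 0 \<le> l j \<and> 0 \<le> s j \<and> y j \<in> {0, 1})}"

definition bigM_coupling :: "real \<Rightarrow> real \<Rightarrow> real \<Rightarrow> bool" where
  "bigM_coupling U s y \<longleftrightarrow> s \<le> U * (1 - y)"

definition indicator_coupling :: "real \<Rightarrow> real \<Rightarrow> bool" where
  "indicator_coupling s y \<longleftrightarrow> (y = 1 \<longrightarrow> s = 0)"

definition program_optimal_solutions ::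
    "(real \<Rightarrow> real \<Rightarrow> bool) \<Rightarrow> ('j::finite \<Rightarrow> real ^ 'z \<Rightarrow> real ^ 'n \<Rightarrow> real) \<Rightarrow>
     real ^ 'n \<Rightarrow> real ^ 'n ^ 'n \<Rightarrow> ('j, 'z, 'n) decision set" where
  "program_optimal_solutions C f \<mu> V =
     {x. is_arg_min fst (\<lambda>x. x \<in> program_feasible C f \<mu> V) x}"

definition program_optimal_value ::
    "(real \<Rightarrow> real \<Rightarrow> bool) \<Rightarrow> ('j::finite \<Rightarrow> real ^ 'z \<Rightarrow> real ^ 'n \<Rightarrow> real) \<Rightarrow>
     real ^ 'n \<Rightarrow> real ^ 'n ^ 'n \<Rightarrow> real" where
  "program_optimal_value C f \<mu> V = (INF x \<in> program_feasible C f \<mu> V. fst x)"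

definition stochastic_flexibility ::
    "('j::finite \<Rightarrow> real ^ 'z \<Rightarrow> real ^ 'n \<Rightarrow> real) \<Rightarrow> real ^ 'n \<Rightarrow> real ^ 'n ^ 'n \<Rightarrow> real" where
  "stochastic_flexibility f \<mu> V =
     (LINT \<theta>:{\<theta>. feasibility_fun f \<theta> \<le> 0}|lborel. gaussian_density \<mu> V \<theta>)"

end

theory Submission
  imports Defs
begin

text \<open>Sublevel sets of the quadratic form \<open>q\<close> of the Gaussian have volume proportional to \<open>t\<^sup>n\<^sup>/\<^sup>2\<close> by scaling, so
  \<open>q / 2\<close> has a density proportional to the Gamma density; the constant is fixed by the total mass 1, so no
  square root of \<open>V\<close> and no determinant is needed.

  If \<open>\<psi>\<close> were positive somewhere on the optimal ellipsoid, then, as \<open>\<psi>(\<mu>) \<le> 0\<close>, it would vanish at an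
  interior point of the segment to the centre, where \<open>q\<close> is smaller than \<open>\<delta>\<^sub>s\<close>. The KKT conditions of the
  inner minimax problem there, with the support of the multipliers cut down by Caratheodory's theorem,
  give a feasible point of the program with a smaller objective. The new point need only satisfy the
  implications \<open>y\<^sub>j = 1 \<longrightarrow> s\<^sub>j = 0\<close>, not the bound \<open>U\<close>, because both programs have the same optimal
  solutions.\<close>

subsection \<open>Mahalanobis distance\<close>

text \<open>Substituting \<open>x = V *v y\<close> turns the quadratic form of the inverse at
  \<open>x\<close> into that of \<open>V\<close> at \<open>y\<close>.\<close>

lemma positive_definite_matrix_inv:
  fixes V :: "real ^ 'n ^ 'n"
  assumes "positive_definite V"
  shows "positive_definite (matrix_inv V)"
proof -
  have "inj ((*v) V)"
    unfolding linear_injective_0[OF matrix_vector_mul_linear]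
  proof (intro allI impI)
    fix x assume "V *v x = 0"
    then show "x = 0" using assms unfolding positive_definite_def by force
  qed
  then have "invertible V"
    by (simp add: matrix_left_invertible_injective invertible_left_inverse)
  then have VV: "V ** matrix_inv V = mat 1"
    unfolding invertible_def matrix_inv_def by (rule someI2_ex) blast
  show ?thesis
    unfolding positive_definite_def
  proof (intro allI impI)
    fix x :: "real ^ 'n" assume "x \<noteq> 0"
    define y where "y = matrix_inv V *v x"
    have x: "x = V *v y"
      by (simp add: y_def matrix_vector_mul_assoc VV)
    with \<open>x \<noteq> 0\<close> have "y \<noteq> 0" by auto
    then have "0 < y \<bullet> (V *v y)" using assms unfolding positive_definite_def by blast
    then show "0 < x \<bullet> (matrix_inv V *v x)"
      unfolding y_def[symmetric] by (simp add: x inner_commute)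
  qed
qed

lemma continuous_on_mahalanobis [continuous_intros]:
  assumes "continuous_on S g"
  shows "continuous_on S (\<lambda>x. mahalanobis \<mu> V (g x))"
  unfolding mahalanobis_def
  by (intro continuous_on_inner continuous_on_diff continuous_on_const assms
      bounded_linear.continuous_on[OF matrix_vector_mul_bounded_linear])

lemma borel_measurable_mahalanobis [measurable]: "mahalanobis \<mu> V \<in> borel_measurable borel"
  by (intro borel_measurable_continuous_onI continuous_on_mahalanobis continuous_on_id)

text \<open>Degree-two homogeneity about the centre: the source of the compactness of ellipsoids, of
  the volume scaling, and of the strict decrease along segments towards
  \<open>\<mu>\<close>.\<close>

lemma mahalanobis_scale: "mahalanobis \<mu> V (\<mu> + t *\<^sub>R v) = t\<^sup>2 * mahalanobis \<mu> V (\<mu> + v)"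
  by (simp add: mahalanobis_def matrix_vector_mult_scaleR power2_eq_square)

lemma mahalanobis_self [simp]: "mahalanobis \<mu> V \<mu> = 0"
  by (simp add: mahalanobis_def)

lemma mahalanobis_pos:
  assumes "positive_definite V" "\<theta> \<noteq> \<mu>"
  shows "0 < mahalanobis \<mu> V \<theta>"
  using positive_definite_matrix_inv[OF assms(1)] assms(2)
  by (simp add: mahalanobis_def positive_definite_def)

lemma mahalanobis_nonneg:
  assumes "positive_definite V"
  shows "0 \<le> mahalanobis \<mu> V \<theta>"
  using mahalanobis_pos[OF assms, of \<theta> \<mu>] by (cases "\<theta> = \<mu>") auto

text \<open>The form attains a positive minimum \<open>q u\<close> on the unit sphere; by
  homogeneity it dominates \<open>q u\<close> times the squared norm, so every sublevel set lies in
  a ball.\<close>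

lemma compact_T_ellip:
  fixes V :: "real ^ 'n ^ 'n"
  assumes "positive_definite V"
  shows "compact (T_ellip \<mu> V r)"
proof -
  define q where "q v = mahalanobis \<mu> V (\<mu> + v)" for v
  have cont: "continuous_on (sphere 0 1) q"
    unfolding q_def by (intro continuous_intros)
  have "sphere (0::real ^ 'n) 1 \<noteq> {}"
    using vector_choose_size[of 1] by (auto simp: sphere_def dist_norm)
  then obtain u where u: "u \<in> sphere 0 1" "\<And>v. v \<in> sphere 0 1 \<Longrightarrow> q u \<le> q v"
    using continuous_attains_inf[OF compact_sphere, of 0 1 q] cont by blast
  have "q u > 0"
    using u(1) unfolding q_def by (intro mahalanobis_pos[OF assms]) auto
  have le: "(norm v)\<^sup>2 * q u \<le> q v" for v
  proof (cases "v = 0")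
    case False
    have "q v = (norm v)\<^sup>2 * q (v /\<^sub>R norm v)"
      using mahalanobis_scale[of \<mu> V "norm v" "v /\<^sub>R norm v"] False by (simp add: q_def)
    moreover have "q u \<le> q (v /\<^sub>R norm v)" using False by (intro u(2)) simp
    ultimately show ?thesis by (simp add: mult_left_mono)
  qed (simp add: q_def)
  have "T_ellip \<mu> V r \<subseteq> cball \<mu> (sqrt (r / q u))"
  proof
    fix \<theta> assume "\<theta> \<in> T_ellip \<mu> V r"
    then have "(norm (\<theta> - \<mu>))\<^sup>2 * q u \<le> r"
      using le[of "\<theta> - \<mu>"] by (simp add: q_def T_ellip_def)
    then have "(norm (\<theta> - \<mu>))\<^sup>2 \<le> r / q u" using \<open>q u > 0\<close> by (simp add: field_simps)
    then show "\<theta> \<in> cball \<mu> (sqrt (r / q u))"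
      by (simp add: dist_norm norm_minus_commute real_le_rsqrt)
  qed
  moreover have "closed (T_ellip \<mu> V r)"
    unfolding T_ellip_def by (intro closed_Collect_le continuous_intros)
  ultimately show ?thesis
    using bounded_subset[OF bounded_cball] by (auto simp: compact_eq_bounded_closed)
qed

text \<open>The sublevel set at \<open>t\<close> is the one at 1 dilated about \<open>\<mu>\<close>
  by \<open>sqrt t\<close>, and a dilation multiplies volume by the \<open>CARD('n)\<close>-th power
  of its factor.\<close>

lemma emeasure_mahalanobis_less:
  fixes V :: "real ^ 'n ^ 'n"
  assumes "positive_definite V" "t > 0"
  shows "emeasure lborel {\<theta>. mahalanobis \<mu> V \<theta> < t} =
    ennreal (t powr (CARD('n) / 2)) * emeasure lborel {\<theta>. mahalanobis \<mu> V \<theta> < 1}"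
proof -
  define m where "m = sqrt t"
  have m: "m > 0" "m\<^sup>2 = t" using assms(2) by (auto simp: m_def)
  \<comment> \<open>The dilation is written as a scaling followed by a translation, the shape
    required by \<open>emeasure_lebesgue_affine\<close>.\<close>
  have eq: "{\<theta>. mahalanobis \<mu> V \<theta> < t} =
    (\<lambda>x. m *\<^sub>R x + (\<mu> - m *\<^sub>R \<mu>)) ` {\<theta>. mahalanobis \<mu> V \<theta> < 1}"
  proof (intro set_eqI iffI)
    fix \<theta> assume "\<theta> \<in> {\<theta>. mahalanobis \<mu> V \<theta> < t}"
    moreover have "mahalanobis \<mu> V \<theta> = m\<^sup>2 * mahalanobis \<mu> V (\<mu> + (\<theta> - \<mu>) /\<^sub>R m)"
      using mahalanobis_scale[of \<mu> V m "(\<theta> - \<mu>) /\<^sub>R m"] m by simp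
    ultimately have "mahalanobis \<mu> V (\<mu> + (\<theta> - \<mu>) /\<^sub>R m) < 1"
      using m assms(2) by simp
    moreover have "\<theta> = m *\<^sub>R (\<mu> + (\<theta> - \<mu>) /\<^sub>R m) + (\<mu> - m *\<^sub>R \<mu>)"
      using m by (simp add: algebra_simps)
    ultimately show "\<theta> \<in> (\<lambda>x. m *\<^sub>R x + (\<mu> - m *\<^sub>R \<mu>)) ` {\<theta>. mahalanobis \<mu> V \<theta> < 1}"
      by blast
  next
    fix \<theta> assume "\<theta> \<in> (\<lambda>x. m *\<^sub>R x + (\<mu> - m *\<^sub>R \<mu>)) ` {\<theta>. mahalanobis \<mu> V \<theta> < 1}"
    then obtain x where x: "mahalanobis \<mu> V x < 1" "\<theta> = m *\<^sub>R x + (\<mu> - m *\<^sub>R \<mu>)" by blast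
    then have "\<theta> = \<mu> + m *\<^sub>R (x - \<mu>)" by (simp add: algebra_simps)
    then have "mahalanobis \<mu> V \<theta> = t * mahalanobis \<mu> V x"
      using mahalanobis_scale[of \<mu> V m "x - \<mu>"] m by simp
    then show "\<theta> \<in> {\<theta>. mahalanobis \<mu> V \<theta> < t}"
      using x(1) assms(2) by simp
  qed
  have sb: "{\<theta>. mahalanobis \<mu> V \<theta> < r} \<in> sets lborel" for r
    by measurable
  have "emeasure lborel {\<theta>. mahalanobis \<mu> V \<theta> < t} =
      emeasure lebesgue {\<theta>. mahalanobis \<mu> V \<theta> < t}"
    using sb by (simp add: emeasure_completion)
  also have "\<dots> = \<bar>m\<bar> ^ DIM(real ^ 'n) * emeasure lebesgue {\<theta>. mahalanobis \<mu> V \<theta> < 1}"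
    unfolding eq by (rule emeasure_lebesgue_affine)
  also have "\<bar>m\<bar> ^ DIM(real ^ 'n) = t powr (CARD('n) / 2)"
  proof -
    have "\<bar>m\<bar> ^ DIM(real ^ 'n) = m powr CARD('n)" using m(1) by (simp add: powr_realpow)
    also have "\<dots> = t powr (CARD('n) / 2)"
      using assms(2) powr_powr[of t "1 / 2" "CARD('n)"] by (simp add: m_def powr_half_sqrt)
    finally show ?thesis by simp
  qed
  finally show ?thesis
    using sb by (simp add: emeasure_completion)
qed

subsection \<open>Gaussian mass of ellipsoids and the chi-squared distribution\<close>

text \<open>Upper tails of the reflected power density. For \<open>a < 1\<close> the integrand is
  unbounded near 0, so the fundamental theorem is used in the form that asks for a derivative only
  in the interior.\<close>

lemma nn_integral_powr_at_zero:
  assumes "a > 0" "x < 0"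
  shows "(\<integral>\<^sup>+s. ennreal ((- s) powr (a - 1)) * indicator {x<..<0} s \<partial>lborel) = ennreal ((- x) powr a / a)"
proof -
  have "((\<lambda>s. (- s) powr (a - 1)) has_integral (- ((- 0) powr a / a) - - ((- x) powr a / a))) {x..0}"
  proof (rule fundamental_theorem_of_calculus_interior)
    show "continuous_on {x..0} (\<lambda>s. - ((- s) powr a / a))"
      using assms by (intro continuous_intros continuous_on_powr') auto
    show "((\<lambda>s. - ((- s) powr a / a)) has_vector_derivative (- s) powr (a - 1)) (at s)"
      if "s \<in> {x<..<0}" for s
      unfolding has_real_derivative_iff_has_vector_derivative[symmetric]
      using that assms by (auto intro!: derivative_eq_intros)
  qed (use assms in auto)
  then have "(\<integral>\<^sup>+s. ennreal (indicator {x..0} s * (- s) powr (a - 1)) \<partial>lborel) = ennreal ((- x) powr a / a)"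
    by (subst nn_integral_has_integral_lebesgue) auto
  moreover have "AE s in lborel. s \<notin> {x, 0}"
    by (intro AE_not_in finite_imp_null_set_lborel) auto
  then have "(\<integral>\<^sup>+s. ennreal (indicator {x..0} s * (- s) powr (a - 1)) \<partial>lborel) =
    (\<integral>\<^sup>+s. ennreal ((- s) powr (a - 1)) * indicator {x<..<0} s \<partial>lborel)"
    by (intro nn_integral_cong_AE, eventually_elim) (auto simp: indicator_def)
  ultimately show ?thesis by simp
qed

text \<open>The Gamma distribution with shape \<open>a\<close> and scale 1; for
  \<open>a = n / 2\<close> it is the law of half a chi-squared variable with \<open>n\<close>
  degrees of freedom.\<close>

definition gamma_measure :: "real \<Rightarrow> real measure" where
  "gamma_measure a = density lborel (\<lambda>t. ennreal (indicator {0..} t * t powr (a - 1) / exp t / Gamma a))"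

text \<open>Volume scaling gives the push-forward of Lebesgue measure under \<open>q / 2\<close> a
  density proportional to \<open>t powr (a - 1)\<close>; the weight turns into
  \<open>exp (- t)\<close>, which makes it a multiple of the Gamma density. A general
  \<open>h\<close> covers both the total mass and the mass of an ellipsoid.\<close>

lemma nn_integral_exp_mahalanobis:
  fixes V :: "real ^ 'n ^ 'n"
  assumes V: "positive_definite V"
  obtains C where "\<And>h. h \<in> borel_measurable borel \<Longrightarrow>
    (\<integral>\<^sup>+\<theta>. ennreal (exp (- mahalanobis \<mu> V \<theta> / 2)) * h (mahalanobis \<mu> V \<theta> / 2) \<partial>lborel) =
    ennreal C * (\<integral>\<^sup>+t. h t \<partial>gamma_measure (CARD('n) / 2))" "0 \<le> C"
proof -
  let ?q = "mahalanobis \<mu> V"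
  define a where "a = real CARD('n) / 2"
  have a: "a > 0" by (simp add: a_def)
  have G: "Gamma a > 0" using a by (rule Gamma_real_pos)
  have "bounded {\<theta>. ?q \<theta> < 1}"
    by (rule bounded_subset[OF compact_imp_bounded[OF compact_T_ellip[OF V, of \<mu> 1]]])
       (auto simp: T_ellip_def)
  then have fin: "emeasure lborel {\<theta>. ?q \<theta> < 1} < \<infinity>"
    using emeasure_bounded_finite by blast
  then obtain c where c: "c \<ge> 0" "emeasure lborel {\<theta>. ?q \<theta> < 1} = ennreal c"
    by (metis ennreal_cases infinity_ennreal_def less_irrefl)
  have vol: "emeasure lborel {\<theta>. ?q \<theta> < t} = ennreal (t powr a * c)" if "t > 0" for t
    using emeasure_mahalanobis_less[OF V that, of \<mu>] c by (simp add: a_def ennreal_mult)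
  \<comment> \<open>The set where \<open>q / 2 < t\<close> has volume
    \<open>c * (2 * t) powr a\<close>, whose derivative in \<open>t\<close> is
    \<open>K * t powr (a - 1)\<close>.\<close>
  define K where "K = a * c * 2 powr a"
  have K: "K \<ge> 0" using a c by (simp add: K_def)
  \<comment> \<open>The push-forward is reflected to \<open>-q/2\<close> so that \<open>measure_eqI_lessThan\<close> applies: its upper tails are
    the sublevel sets of \<open>q\<close>, which have finite volume.\<close>
  have distr: "distr lborel borel (\<lambda>\<theta>. - (?q \<theta> / 2)) =
    density lborel (\<lambda>s. ennreal K * (ennreal ((- s) powr (a - 1)) * indicator {..<0} s))"
    (is "?L = ?R")
  proof (rule measure_eqI_lessThan)
    fix x :: real
    have L: "emeasure ?L {x<..} = emeasure lborel {\<theta>. ?q \<theta> < - 2 * x}"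
      by (subst emeasure_distr) (auto intro!: arg_cong[where f = "emeasure lborel"])
    have R: "emeasure ?R {x<..} =
        ennreal K * (\<integral>\<^sup>+s. ennreal ((- s) powr (a - 1)) * indicator {x<..<0} s \<partial>lborel)"
      by (subst emeasure_density, simp, simp, subst nn_integral_cmult[symmetric], simp)
         (auto intro!: nn_integral_cong simp: indicator_def)
    have "emeasure ?L {x<..} = emeasure ?R {x<..} \<and> emeasure ?L {x<..} < \<infinity>"
    proof (cases "x < 0")
      case True
      have "(- 2 * x) powr a * c = K * ((- x) powr a / a)"
        using a True powr_mult[of 2 "- x" a] by (simp add: K_def)
      then show ?thesis
        using True vol[of "- 2 * x"] K
        unfolding L R nn_integral_powr_at_zero[OF a True] by (simp add: ennreal_mult'[symmetric])
    next
      case False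
      then have e: "{\<theta>. ?q \<theta> < - 2 * x} = {}" "{x<..<0} = {}"
        using mahalanobis_nonneg[OF V, of \<mu>] by (auto simp: not_less intro: order_trans[of _ 0])
      show ?thesis unfolding L R e by simp
    qed
    then show "emeasure ?L {x<..} < \<infinity>" "emeasure ?L {x<..} = emeasure ?R {x<..}" by auto
  qed auto
  show ?thesis
  proof (rule that[of "K * Gamma a"])
    fix h :: "real \<Rightarrow> ennreal" assume [measurable]: "h \<in> borel_measurable borel"
    have "(\<integral>\<^sup>+\<theta>. ennreal (exp (- ?q \<theta> / 2)) * h (?q \<theta> / 2) \<partial>lborel) =
        (\<integral>\<^sup>+s. ennreal (exp s) * h (- s) \<partial>?L)"
      by (subst nn_integral_distr) auto
    also have "\<dots> = (\<integral>\<^sup>+s. ennreal K * (ennreal ((- s) powr (a - 1)) * indicator {..<0} s) *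
        (ennreal (exp s) * h (- s)) \<partial>lborel)"
      unfolding distr by (subst nn_integral_density) auto
    also have "\<dots> = (\<integral>\<^sup>+t. ennreal K * (ennreal (t powr (a - 1)) * indicator {..<0} (- t)) *
        (ennreal (exp (- t)) * h t) \<partial>lborel)"
      by (subst nn_integral_real_affine[where c = "-1" and t = 0]) auto
    also have "\<dots> = (\<integral>\<^sup>+t. ennreal (K * Gamma a) *
        (ennreal (indicator {0..} t * t powr (a - 1) / exp t / Gamma a) * h t) \<partial>lborel)"
    proof (rule nn_integral_cong)
      fix t :: real
      show "ennreal K * (ennreal (t powr (a - 1)) * indicator {..<0} (- t)) * (ennreal (exp (- t)) * h t) =
        ennreal (K * Gamma a) * (ennreal (indicator {0..} t * t powr (a - 1) / exp t / Gamma a) * h t)"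
      \<comment> \<open>At \<open>t = 0\<close> the two indicators differ, but both sides vanish
        because \<open>0 powr (a - 1)\<close> is 0.\<close>
      proof (cases "t > 0")
        case True
        define d where "d = t powr (a - 1) / exp t / Gamma a"
        have "d \<ge> 0" using G by (simp add: d_def)
        have "ennreal K * (ennreal (t powr (a - 1)) * indicator {..<0} (- t)) * (ennreal (exp (- t)) * h t) =
            ennreal (K * t powr (a - 1) * exp (- t)) * h t"
          using True K by (simp add: ennreal_mult mult.assoc)
        also have "K * t powr (a - 1) * exp (- t) = K * Gamma a * d"
          using G by (simp add: d_def exp_minus divide_simps)
        also have "ennreal (K * Gamma a * d) * h t = ennreal (K * Gamma a) * (ennreal d * h t)"
          using K G \<open>d \<ge> 0\<close> by (simp add: ennreal_mult mult.assoc)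
        finally show ?thesis using True by (simp add: d_def)
      qed (auto simp: indicator_def)
    qed
    also have "\<dots> = ennreal (K * Gamma a) * (\<integral>\<^sup>+t. h t \<partial>gamma_measure a)"
      unfolding gamma_measure_def using G
      by (subst nn_integral_density, measurable) (simp add: nn_integral_cmult)
    finally show "(\<integral>\<^sup>+\<theta>. ennreal (exp (- ?q \<theta> / 2)) * h (?q \<theta> / 2) \<partial>lborel) =
      ennreal (K * Gamma a) * (\<integral>\<^sup>+t. h t \<partial>gamma_measure (CARD('n) / 2))"
      by (simp add: a_def)
  qed (use K G in auto)
qed

lemma real_distribution_gamma_measure:
  assumes "a > 0"
  shows "real_distribution (gamma_measure a)"
proof -
  have G: "Gamma a > 0" using assms by (rule Gamma_real_pos)
  have "emeasure (gamma_measure a) (space (gamma_measure a)) =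
      (\<integral>\<^sup>+t. ennreal (1 / Gamma a) * ennreal (indicator {0..} t * t powr (a - 1) / exp t) \<partial>lborel)"
    unfolding gamma_measure_def using G
    by (subst emeasure_density) (auto intro!: nn_integral_cong simp: ennreal_mult'[symmetric])
  also have "\<dots> = ennreal (1 / Gamma a) * ennreal (Gamma a)"
    by (subst nn_integral_cmult) (auto simp: Gamma_conv_nn_integral_real[OF assms])
  also have "\<dots> = 1" using G by (simp add: ennreal_mult'[symmetric])
  finally have "prob_space (gamma_measure a)" by (rule prob_spaceI)
  then show ?thesis
    by (auto simp: real_distribution_def real_distribution_axioms_def gamma_measure_def)
qed

text \<open>Expresses the explicit formula through a probability measure, so that general facts
  about \<open>cdf\<close> apply; the argument is halved to match \<open>q / 2\<close>.\<close>

lemma chi_square_cdf_eq_gamma_cdf: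
  assumes "n > 0"
  shows "chi_square_cdf n r = cdf (gamma_measure (n / 2)) (r / 2)"
proof -
  define a where "a = real n / 2"
  have G: "Gamma a > 0" using assms by (simp add: a_def Gamma_real_pos)
  have "cdf (gamma_measure a) (r / 2) =
      enn2real (\<integral>\<^sup>+ t. ennreal (indicator {0..r / 2} t * (t powr (a - 1) * exp (- t)) / Gamma a) \<partial>lborel)"
    unfolding cdf_def measure_def gamma_measure_def
    by (subst emeasure_density)
       (auto intro!: arg_cong[where f = enn2real] nn_integral_cong simp: indicator_def exp_minus field_simps)
  also have "\<dots> = (LINT t|lborel. indicator {0..r / 2} t * (t powr (a - 1) * exp (- t)) / Gamma a)"
    using G by (intro integral_eq_nn_integral[symmetric]) auto
  also have "\<dots> = chi_square_cdf n r"
    by (simp add: chi_square_cdf_def lower_incomplete_Gamma_def set_lebesgue_integral_def a_def)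
  finally show ?thesis by (simp add: a_def)
qed

text \<open>The density is positive on \<open>{x<..y}\<close>, so zero mass there would make this
  interval a Lebesgue null set.\<close>

lemma cdf_gamma_measure_strict_mono:
  assumes "a > 0" "0 \<le> x" "x < y"
  shows "cdf (gamma_measure a) x < cdf (gamma_measure a) y"
proof -
  interpret real_distribution "gamma_measure a" by (rule real_distribution_gamma_measure) fact
  have G: "Gamma a > 0" using assms by (simp add: Gamma_real_pos)
  have "emeasure (gamma_measure a) {x<..y} \<noteq> 0"
  proof
    assume "emeasure (gamma_measure a) {x<..y} = 0"
    then have "(\<integral>\<^sup>+t. ennreal (indicator {0..} t * t powr (a - 1) / exp t / Gamma a) * indicator {x<..y} t \<partial>lborel) = 0"
      unfolding gamma_measure_def by (subst (asm) emeasure_density) auto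
    then have "AE t in lborel. ennreal (indicator {0..} t * t powr (a - 1) / exp t / Gamma a) * indicator {x<..y} t = 0"
      by (subst (asm) nn_integral_0_iff_AE) auto
    then have "AE t in lborel. t \<notin> {x<..y}"
    proof eventually_elim
      case (elim t)
      show ?case
      proof
        assume t: "t \<in> {x<..y}"
        then have "t powr (a - 1) / exp t / Gamma a > 0" using G assms(2) by simp
        with elim t assms(2) show False by (simp add: ennreal_eq_0_iff)
      qed
    qed
    then have "emeasure lborel {x<..y} = 0"
      by (subst (asm) AE_iff_measurable[of "{x<..y}"]) auto
    then show False using assms by simp
  qed
  then have "measure (gamma_measure a) {x<..y} > 0"
    by (simp add: emeasure_eq_measure measure_nonneg less_le)
  then show ?thesis using cdf_diff_eq[OF assms(3)] by simp
qed

text \<open>Strict monotonicity gives injectivity; the value 0 at 0, continuity and the limit 1 give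
  surjectivity by the intermediate value theorem.\<close>

lemma bij_betw_chi_square_cdf:
  assumes "n > 0"
  shows "bij_betw (chi_square_cdf n) {0..} {0..<1}"
proof -
  define F where "F = cdf (gamma_measure (real n / 2))"
  have n: "real n / 2 > 0" using assms by simp
  interpret real_distribution "gamma_measure (real n / 2)"
    by (rule real_distribution_gamma_measure) fact
  have eq: "chi_square_cdf n r = F (r / 2)" for r
    using chi_square_cdf_eq_gamma_cdf[OF assms] by (simp add: F_def)
  have mono: "F x < F y" if "0 \<le> x" "x < y" for x y
    unfolding F_def by (rule cdf_gamma_measure_strict_mono) (use that n in auto)
  have F0: "F 0 = 0"
  proof -
    \<comment> \<open>The range is the single point 0, where \<open>powr\<close> returns 0.\<close>
    have "(\<lambda>t. indicator {0..0} t *\<^sub>R (t powr (real n / 2 - 1) * exp (- t))) = (\<lambda>_. 0)"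
      by (auto simp: indicator_def)
    then have "lower_incomplete_Gamma (real n / 2) 0 = 0"
      by (simp only: lower_incomplete_Gamma_def set_lebesgue_integral_def integral_zero)
    then show ?thesis using eq[of 0] by (simp add: chi_square_cdf_def)
  qed
  have cont: "isCont F x" for x
  proof -
    \<comment> \<open>A distribution function is continuous exactly where its measure has no
      atom.\<close>
    have "emeasure (gamma_measure (real n / 2)) {x} = 0"
      unfolding gamma_measure_def by (subst emeasure_density) 
        (auto simp: nn_integral_0_iff_AE indicator_def intro!: eventually_mono[OF AE_lborel_singleton[of x]])
    then show ?thesis unfolding F_def isCont_cdf by (simp add: measure_def)
  qed
  have lim: "(F \<longlongrightarrow> 1) at_top" unfolding F_def by (rule cdf_lim_at_top_prob)
  have inj: "inj_on (chi_square_cdf n) {0..}"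
  proof (rule linorder_inj_onI)
    fix x y :: real assume "x < y" "x \<in> {0..}"
    then show "chi_square_cdf n x \<noteq> chi_square_cdf n y"
      using mono[of "x / 2" "y / 2"] by (simp add: eq)
  qed auto
  moreover have "chi_square_cdf n ` {0..} = {0..<1}"
  proof (intro equalityI subsetI)
    fix p assume "p \<in> chi_square_cdf n ` {0..}"
    then obtain r where "r \<ge> 0" "p = F (r / 2)" by (auto simp: eq)
    \<comment> \<open>The value 1 is never reached: \<open>F\<close> is still strictly larger
      further to the right and bounded by 1.\<close>
    moreover have "F (r / 2) < F (r / 2 + 1)" using \<open>r \<ge> 0\<close> by (intro mono) auto
    ultimately show "p \<in> {0..<1}"
      using cdf_bounded_prob[of "r / 2 + 1"] cdf_nonneg[of "r / 2"] by (auto simp: F_def)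
  next
    fix p :: real assume p: "p \<in> {0..<1}"
    have "eventually (\<lambda>x. F x > p \<and> x \<ge> 0) at_top"
      using lim p by (intro eventually_conj order_tendstoD(1)[OF lim] eventually_ge_at_top) auto
    then obtain b where b: "F b > p" "b \<ge> 0" by (auto simp: eventually_at_top_linorder)
    have "\<exists>x. 0 \<le> x \<and> x \<le> b \<and> F x = p"
      using p b F0 cont by (intro IVT) auto
    then obtain x where "0 \<le> x" "F x = p" by blast
    then show "p \<in> chi_square_cdf n ` {0..}"
      by (intro image_eqI[of _ _ "2 * x"]) (auto simp: eq)
  qed
  ultimately show ?thesis by (simp add: bij_betw_def)
qed

text \<open>The transfer to \<open>gamma_measure\<close> is used twice: \<open>h = 1\<close>
  together with \<open>total\<close> fixes the constant, and an indicator then gives the mass of the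
  ellipsoid.\<close>

lemma gaussian_measure_T_ellip:
  fixes V :: "real ^ 'n ^ 'n"
  assumes V: "positive_definite V"
    and total: "(\<integral>\<^sup>+\<theta>. ennreal (gaussian_density \<mu> V \<theta>) \<partial>lborel) = 1"
  shows "(\<integral>\<^sup>+\<theta>. ennreal (gaussian_density \<mu> V \<theta>) * indicator (T_ellip \<mu> V r) \<theta> \<partial>lborel) =
    ennreal (chi_square_cdf CARD('n) r)"
proof -
  let ?q = "mahalanobis \<mu> V" and ?N = "gamma_measure (CARD('n) / 2)"
  define S where "S = sqrt ((2 * pi) ^ CARD('n) * det V)"
  interpret N: real_distribution ?N
    by (rule real_distribution_gamma_measure) simp
  obtain C where C: "\<And>h. h \<in> borel_measurable borel \<Longrightarrow>
    (\<integral>\<^sup>+\<theta>. ennreal (exp (- ?q \<theta> / 2)) * h (?q \<theta> / 2) \<partial>lborel) = ennreal C * (\<integral>\<^sup>+t. h t \<partial>?N)" "0 \<le> C"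
    using nn_integral_exp_mahalanobis[OF V, of \<mu>] by blast
  \<comment> \<open>Otherwise the density would be nonpositive everywhere, also when
    \<open>S = 0\<close> since division by 0 yields 0, against \<open>total\<close>.\<close>
  have S: "S > 0"
  proof (rule ccontr)
    assume "\<not> S > 0"
    then have "gaussian_density \<mu> V \<theta> \<le> 0" for \<theta>
      unfolding gaussian_density_def S_def[symmetric] by (simp add: divide_nonneg_nonpos)
    then show False using total by (simp add: ennreal_neg)
  qed
  have gen: "(\<integral>\<^sup>+\<theta>. ennreal (gaussian_density \<mu> V \<theta>) * h (?q \<theta> / 2) \<partial>lborel) =
      ennreal (C / S) * (\<integral>\<^sup>+t. h t \<partial>?N)" if [measurable]: "h \<in> borel_measurable borel" for h
  proof -
    have "(\<integral>\<^sup>+\<theta>. ennreal (gaussian_density \<mu> V \<theta>) * h (?q \<theta> / 2) \<partial>lborel) =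
      (\<integral>\<^sup>+\<theta>. ennreal (1 / S) * (ennreal (exp (- ?q \<theta> / 2)) * h (?q \<theta> / 2)) \<partial>lborel)"
      unfolding gaussian_density_def S_def[symmetric] using S
      by (intro nn_integral_cong) (simp add: mult.assoc[symmetric] ennreal_mult'[symmetric])
    also have "\<dots> = ennreal (1 / S) * (ennreal C * (\<integral>\<^sup>+t. h t \<partial>?N))"
      using C(1)[OF that] by (subst nn_integral_cmult) auto
    finally show ?thesis using S C(2) by (simp add: mult.assoc[symmetric] ennreal_mult'[symmetric])
  qed
  have one: "ennreal (C / S) = 1"
    using gen[of "\<lambda>_. 1"] total N.emeasure_space_1 by simp
  have "(\<integral>\<^sup>+\<theta>. ennreal (gaussian_density \<mu> V \<theta>) * indicator (T_ellip \<mu> V r) \<theta> \<partial>lborel) =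
      (\<integral>\<^sup>+\<theta>. ennreal (gaussian_density \<mu> V \<theta>) * indicator {..r / 2} (?q \<theta> / 2) \<partial>lborel)"
    by (intro nn_integral_cong) (simp add: T_ellip_def indicator_def)
  also have "\<dots> = emeasure ?N {..r / 2}"
    by (subst gen) (auto simp: one)
  also have "\<dots> = ennreal (chi_square_cdf CARD('n) r)"
    by (simp add: chi_square_cdf_eq_gamma_cdf N.emeasure_eq_measure cdf_def)
  finally show ?thesis .
qed

subsection \<open>Minimax stationarity and the mixed-integer program\<close>

text \<open>As \<open>gradient\<close> is a definite description, both existence and uniqueness are
  due. The representing vector of the derivative is its adjoint applied to 1.\<close>

lemma GDERIV_gradient:
  fixes g :: "'a::euclidean_space \<Rightarrow> real"
  assumes "g differentiable at x"
  shows "GDERIV g x :> gradient g x"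
proof -
  obtain D where D: "(g has_derivative D) (at x)"
    using assms by (auto simp: differentiable_def)
  interpret D: bounded_linear D using D by (rule has_derivative_bounded_linear)
  have "D h = h \<bullet> adjoint D 1" for h
    using adjoint_works[OF D.linear_axioms, of h 1] by (simp add: inner_real_def)
  then have "D = (\<lambda>h. h \<bullet> adjoint D 1)" by (rule ext)
  with D have 1: "GDERIV g x :> adjoint D 1"
    unfolding gderiv_def by simp
  have 2: "E = E'" if "GDERIV g x :> E" "GDERIV g x :> E'" for E E'
  proof -
    have "(\<lambda>h. h \<bullet> E) = (\<lambda>h. h \<bullet> E')"
      using that unfolding gderiv_def by (rule has_derivative_unique)
    then have "h \<bullet> E = h \<bullet> E'" for h by (rule fun_cong)
    then show ?thesis using vector_eq_ldot[of E E'] by simp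
  qed
  show ?thesis
    unfolding gradient_def by (rule theI[where a = "adjoint D 1"]) (rule 1, rule 2[OF _ 1])
qed

text \<open>Phrased with \<open>eventually\<close>, so that finitely many functions can share one
  step length.\<close>

lemma GDERIV_descent:
  assumes "GDERIV g x :> D" "D \<bullet> d < 0"
  shows "eventually (\<lambda>t. g (x + t *\<^sub>R d) < g x) (at_right 0)"
proof -
  have "((\<lambda>t. g (x + t *\<^sub>R d)) has_derivative (\<lambda>t. (t *\<^sub>R d) \<bullet> D)) (at 0)"
  proof (rule has_derivative_compose[where f = "\<lambda>t. x + t *\<^sub>R d" and g = g])
    show "((\<lambda>t. x + t *\<^sub>R d) has_derivative (\<lambda>t. t *\<^sub>R d)) (at 0)"
      by (auto intro!: derivative_eq_intros)
    show "(g has_derivative (\<lambda>h. h \<bullet> D)) (at (x + 0 *\<^sub>R d))"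
      using assms(1) by (simp add: gderiv_def)
  qed
  then have "((\<lambda>t. g (x + t *\<^sub>R d)) has_real_derivative (D \<bullet> d)) (at 0)"
    by (simp add: has_field_derivative_def inner_commute mult.commute[of _ "D \<bullet> d"])
  from DERIV_neg_dec_right[OF this assms(2)] obtain e where
    "e > 0" "\<And>h. 0 < h \<Longrightarrow> h < e \<Longrightarrow> g (x + h *\<^sub>R d) < g x" by auto
  then show ?thesis unfolding eventually_at_right_field by auto
qed

text \<open>Stationarity for a minimax point: otherwise a direction separating the origin from the convex hull of the
  active gradients decreases every active function, hence the maximum.\<close>

lemma minimax_stationary:
  fixes g :: "'j::finite \<Rightarrow> 'a::euclidean_space \<Rightarrow> real"
  assumes diff: "\<And>j. g j differentiable at z"
    and min: "\<And>w. (MAX j. g j z) \<le> (MAX j. g j w)"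
  shows "0 \<in> convex hull ((\<lambda>j. gradient (g j) z) ` {j. g j z = (MAX j. g j z)})"
proof (rule ccontr)
  define m where "m = (MAX j. g j z)"
  define A where "A = (\<lambda>j. gradient (g j) z) ` {j. g j z = m}"
  assume "0 \<notin> convex hull ((\<lambda>j. gradient (g j) z) ` {j. g j z = (MAX j. g j z)})"
  then have "0 \<notin> convex hull A" by (simp add: A_def m_def)
  moreover have "closed (convex hull A)"
    by (intro compact_imp_closed finite_imp_compact_convex_hull) (simp add: A_def)
  ultimately obtain d b where d: "0 < b" "\<And>x. x \<in> convex hull A \<Longrightarrow> b < d \<bullet> x"
    using separating_hyperplane_closed_0[OF convex_convex_hull, of A] by blast
  have "eventually (\<lambda>t. g j (z + t *\<^sub>R (- d)) < m) (at_right 0)" for j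
  proof (cases "g j z = m")
    case True
    then have "gradient (g j) z \<in> convex hull A" by (intro hull_inc) (auto simp: A_def)
    from d(2)[OF this] d(1) have "gradient (g j) z \<bullet> (- d) < 0" by (simp add: inner_commute)
    from GDERIV_descent[OF GDERIV_gradient[OF diff] this] True show ?thesis by simp
  \<comment> \<open>Inactive functions may grow along the direction, but by continuity they stay
    below \<open>m\<close> for small steps.\<close>
  next
    case False
    moreover have "g j z \<le> m" unfolding m_def by (rule Max_ge) auto
    ultimately have "g j z < m" by simp
    moreover have "isCont (g j) z" using diff by (rule differentiable_imp_continuous_within)
    then have "((\<lambda>t. g j (z + t *\<^sub>R (- d))) \<longlongrightarrow> g j z) (at_right 0)"
      by (rule isCont_tendsto_compose) (auto intro!: tendsto_eq_intros)
    ultimately show ?thesis by (auto dest: order_tendstoD(2))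
  qed
  then have "eventually (\<lambda>t. \<forall>j. g j (z + t *\<^sub>R (- d)) < m) (at_right 0)"
    by (simp add: eventually_all_finite)
  then obtain t where "\<forall>j. g j (z + t *\<^sub>R (- d)) < m"
    using eventually_happens'[OF trivial_limit_at_right_real] by blast
  then have "(MAX j. g j (z + t *\<^sub>R (- d))) < m" by simp
  with min[of "z + t *\<^sub>R (- d)"] show False unfolding m_def by linarith
qed

text \<open>Independence of any \<open>n\<^sub>z\<close> gradients rules out a Caratheodory representation with fewer than \<open>n\<^sub>z + 1\<close>
  indices.\<close>

lemma convex_hull_indexed_representation:
  fixes G :: "'j::finite \<Rightarrow> real ^ 'z"
  assumes hull: "0 \<in> convex hull (G ` A)"
    and indep: "\<And>S. card S = CARD('z) \<Longrightarrow> inj_on G S \<and> independent (G ` S)"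
    and card: "CARD('z) \<le> CARD('j)"
  obtains B l where "B \<subseteq> A" "card B = CARD('z) + 1" "\<And>j. 0 \<le> l j" "\<And>j. j \<notin> B \<Longrightarrow> l j = 0"
    "sum l UNIV = 1" "(\<Sum>j\<in>UNIV. l j *\<^sub>R G j) = 0"
proof -
  obtain T u where T: "finite T" "T \<subseteq> G ` A" "card T \<le> DIM(real ^ 'z) + 1" "\<forall>x\<in>T. 0 \<le> u x"
    "sum u T = 1" "(\<Sum>v\<in>T. u v *\<^sub>R v) = 0"
    using hull unfolding convex_hull_caratheodory by blast
  \<comment> \<open>One index for each vector of \<open>T\<close> makes \<open>G\<close> injective
    on \<open>B\<close>, so sums and cardinalities carry over from \<open>T\<close>.\<close>
  obtain B where B: "B \<subseteq> A" "inj_on G B" "T = G ` B"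
    using T(2) by (metis subset_image_inj)
  define l where "l j = (if j \<in> B then u (G j) else 0)" for j
  have l1: "sum l UNIV = 1"
    using T(5) B(2,3) by (simp add: l_def sum.reindex sum.If_cases)
  have "(\<Sum>j\<in>UNIV. l j *\<^sub>R G j) = (\<Sum>j\<in>B. u (G j) *\<^sub>R G j)"
    unfolding l_def by (rule sum.mono_neutral_cong_right) auto
  then have l0: "(\<Sum>j\<in>UNIV. l j *\<^sub>R G j) = 0"
    using T(6) B(2,3) by (simp add: sum.reindex)
  have "card B \<le> CARD('z) + 1"
    using T(3) B(2,3) by (simp add: card_image)
  moreover have "\<not> card B \<le> CARD('z)"
  proof
    assume "card B \<le> CARD('z)"
    \<comment> \<open>A smaller \<open>B\<close> is padded to exactly \<open>CARD('z)\<close>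
      indices to bring in \<open>indep\<close>; independence then kills all weights, which sum to
      1.\<close>
    then obtain S where S: "B \<subseteq> S" "card S = CARD('z)"
      using card by (metis exists_subset_between finite subset_UNIV)
    then have ind: "inj_on G S" "independent (G ` S)" using indep by auto
    then have "independent T" using S(1) B(3) by (metis independent_mono image_mono)
    then have "\<forall>v\<in>T. u v = 0" using T(1,6) by (auto simp: independent_explicit)
    then show False using T(5) by simp
  qed
  ultimately have "card B = CARD('z) + 1" by simp
  then show ?thesis
    using that[of B l] B l1 l0 T(4) by (auto simp: l_def)
qed

text \<open>At a minimizer \<open>z\<close> the largest constraint value is 0, so the negated values
  are admissible slacks and the active constraints are those with zero slack. Stationarity and
  Caratheodory supply the multipliers.\<close>

lemma program_feasible_of_feasibility_zero:
  fixes f :: "'j::finite \<Rightarrow> real ^ 'z \<Rightarrow> real ^ 'n \<Rightarrow> real"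
  assumes V: "positive_definite V"
    and f_diff: "\<And>j z \<theta>. (\<lambda>z. f j z \<theta>) differentiable (at z)"
    and psi_attained: "\<exists>z. \<forall>z'. (MAX j. f j z \<theta>) \<le> (MAX j. f j z' \<theta>)"
    and grad_indep: "\<And>z \<theta> S. card S = CARD('z) \<Longrightarrow>
          inj_on (\<lambda>j. gradient (\<lambda>w. f j w \<theta>) z) S \<and>
          independent ((\<lambda>j. gradient (\<lambda>w. f j w \<theta>) z) ` S)"
    and card: "CARD('z) \<le> CARD('j)"
    and zero: "feasibility_fun f \<theta> = 0"
  obtains x where "x \<in> program_feasible indicator_coupling f \<mu> V" "fst x = mahalanobis \<mu> V \<theta>"
proof -
  obtain z where z: "\<And>z'. (MAX j. f j z \<theta>) \<le> (MAX j. f j z' \<theta>)"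
    using psi_attained by blast
  have m: "(MAX j. f j z \<theta>) = 0"
    using zero z unfolding feasibility_fun_def by (subst (asm) cInf_eq_minimum[of "MAX j. f j z \<theta>"]) auto
  have f_le: "f j z \<theta> \<le> 0" for j
    unfolding m[symmetric] by (rule Max_ge) auto
  obtain B l where B: "B \<subseteq> {j. f j z \<theta> = 0}" "card B = CARD('z) + 1"
    and l: "\<And>j. 0 \<le> l j" "\<And>j. j \<notin> B \<Longrightarrow> l j = 0" "sum l UNIV = 1"
      "(\<Sum>j\<in>UNIV. l j *\<^sub>R gradient (\<lambda>w. f j w \<theta>) z) = 0"
    using convex_hull_indexed_representation[OF minimax_stationary[where g = "\<lambda>j w. f j w \<theta>", OF f_diff z]
        grad_indep card]
    unfolding m by blast
  have l1: "l j \<le> 1" for j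
    unfolding l(3)[symmetric] using l(1) by (intro member_le_sum) auto
  \<comment> \<open>The binaries mark \<open>B\<close>: its elements are active, so their slacks
    vanish, and its size is the required \<open>CARD('z) + 1\<close>.\<close>
  have "(mahalanobis \<mu> V \<theta>, z, \<theta>, l, \<lambda>j. - f j z \<theta>, \<lambda>j. indicator B j) \<in>
    program_feasible indicator_coupling f \<mu> V"
    unfolding program_feasible_def indicator_coupling_def
    using B l l1 f_le mahalanobis_nonneg[OF V, of \<mu> \<theta>]
    by (auto simp: indicator_def of_nat_Suc sum.If_cases)
  then show ?thesis by (rule that) simp
qed

lemma feasibility_fun_nonpos_on_T_ellip:
  fixes f :: "'j::finite \<Rightarrow> real ^ 'z \<Rightarrow> real ^ 'n \<Rightarrow> real"
  assumes V: "positive_definite V"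
    and f_diff: "\<And>j z \<theta>. (\<lambda>z. f j z \<theta>) differentiable (at z)"
    and psi_attained: "\<And>\<theta>. \<exists>z. \<forall>z'. (MAX j. f j z \<theta>) \<le> (MAX j. f j z' \<theta>)"
    and psi_cont: "continuous_on UNIV (feasibility_fun f)"
    and grad_indep: "\<And>z \<theta> S. card S = CARD('z) \<Longrightarrow>
          inj_on (\<lambda>j. gradient (\<lambda>w. f j w \<theta>) z) S \<and>
          independent ((\<lambda>j. gradient (\<lambda>w. f j w \<theta>) z) ` S)"
    and flex: "flexibility_feasible f \<mu> V \<delta>\<^sub>0"
    and opt: "x \<in> program_optimal_solutions indicator_coupling f \<mu> V"
  shows "T_ellip \<mu> V (fst x) \<subseteq> {\<theta>. feasibility_fun f \<theta> \<le> 0}"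
proof (rule ccontr)
  let ?\<psi> = "feasibility_fun f" and ?q = "mahalanobis \<mu> V"
  assume "\<not> T_ellip \<mu> V (fst x) \<subseteq> {\<theta>. ?\<psi> \<theta> \<le> 0}"
  then obtain \<theta>\<^sub>1 where "\<theta>\<^sub>1 \<in> T_ellip \<mu> V (fst x)" "\<not> ?\<psi> \<theta>\<^sub>1 \<le> 0"
    by blast
  then have \<theta>1: "?q \<theta>\<^sub>1 \<le> fst x" "?\<psi> \<theta>\<^sub>1 > 0" by (simp_all add: T_ellip_def)
  \<comment> \<open>Compactness bounds \<open>\<psi>\<close> on the ellipsoid, without which the
    supremum would say nothing about the value at the centre.\<close>
  have "compact (?\<psi> ` T_ellip \<mu> V \<delta>\<^sub>0)"
    by (intro compact_continuous_image continuous_on_subset[OF psi_cont] compact_T_ellip[OF V]) auto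
  moreover have "\<mu> \<in> T_ellip \<mu> V \<delta>\<^sub>0"
    using flex by (simp add: T_ellip_def flexibility_feasible_def)
  ultimately have "?\<psi> \<mu> \<le> (SUP \<theta> \<in> T_ellip \<mu> V \<delta>\<^sub>0. ?\<psi> \<theta>)"
    by (intro cSUP_upper bounded_imp_bdd_above compact_imp_bounded) auto
  then have \<mu>: "?\<psi> \<mu> \<le> 0" using flex by (simp add: flexibility_feasible_def)
  define p where "p t = \<mu> + t *\<^sub>R (\<theta>\<^sub>1 - \<mu>)" for t :: real
  have "continuous_on {0..1} (\<lambda>t. ?\<psi> (p t))"
    unfolding p_def by (intro continuous_on_compose2[OF psi_cont] continuous_intros) auto
  then have "\<exists>t. 0 \<le> t \<and> t \<le> 1 \<and> ?\<psi> (p t) = 0"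
    using \<mu> \<theta>1 by (intro IVT') (auto simp: p_def)
  then obtain t where t: "0 \<le> t" "t \<le> 1" "?\<psi> (p t) = 0" by blast
  \<comment> \<open>The zero may be the centre itself; what counts is \<open>t < 1\<close>, which
    makes the distance strictly smaller than at \<open>\<theta>\<^sub>1\<close>.\<close>
  have "t \<noteq> 1" using t(3) \<theta>1(2) by (auto simp: p_def)
  then have "t\<^sup>2 < 1" using t by (simp add: power_less_one_iff abs_square_less_1)
  moreover have "\<theta>\<^sub>1 \<noteq> \<mu>" using \<mu> \<theta>1 by auto
  ultimately have "?q (p t) < ?q \<theta>\<^sub>1"
    using mahalanobis_scale[of \<mu> V t "\<theta>\<^sub>1 - \<mu>"] mahalanobis_pos[OF V, of \<theta>\<^sub>1 \<mu>] by (simp add: p_def)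
  then have less: "?q (p t) < fst x" using \<theta>1(1) by simp
  have xf: "x \<in> program_feasible indicator_coupling f \<mu> V"
    and xm: "\<And>y. y \<in> program_feasible indicator_coupling f \<mu> V \<Longrightarrow> fst x \<le> fst y"
    using opt unfolding program_optimal_solutions_def is_arg_min_linorder mem_Collect_eq by blast+
  \<comment> \<open>A feasible point has \<open>CARD('z) + 1\<close> binaries equal to 1, which
    bounds the number of constraints from below.\<close>
  obtain y :: "'j \<Rightarrow> real" where y: "(\<Sum>j\<in>UNIV. y j) = real CARD('z) + 1" "\<And>j. y j \<in> {0, 1}"
    using xf unfolding program_feasible_def by blast
  have "(\<Sum>j\<in>UNIV. y j) \<le> (\<Sum>j\<in>(UNIV :: 'j set). 1)"
    using y(2) by (intro sum_mono) (metis insert_iff empty_iff zero_le_one order_refl)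
  then have "CARD('z) \<le> CARD('j)" using y(1) by simp
  then obtain w where "w \<in> program_feasible indicator_coupling f \<mu> V" "fst w = ?q (p t)"
    using program_feasible_of_feasibility_zero[OF V f_diff psi_attained grad_indep _ t(3)] by blast
  then show False using xm[of w] less by simp
qed

theorem theorem4:
  fixes f :: "'j::finite \<Rightarrow> real ^ 'z \<Rightarrow> real ^ 'n \<Rightarrow> real"
    and \<mu> :: "real ^ 'n" and V :: "real ^ 'n ^ 'n"
    and U \<delta>\<^sub>s \<alpha>\<^sub>s :: real
    and M :: "'w measure" and X :: "'w \<Rightarrow> real ^ 'n"
  assumes V_sym: "transpose V = V" and V_pos: "positive_definite V"
    and f_cont: "\<And>j. continuous_on UNIV (\<lambda>(z, \<theta>). f j z \<theta>)"
    and f_diff: "\<And>j z \<theta>. (\<lambda>z. f j z \<theta>) differentiable (at z)"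
    and f_convex: "\<And>j \<theta>. convex_on UNIV (\<lambda>z. f j z \<theta>)"
    and psi_attained: "\<And>\<theta>. \<exists>z. \<forall>z'. (MAX j. f j z \<theta>) \<le> (MAX j. f j z' \<theta>)"
    and psi_cont: "continuous_on UNIV (feasibility_fun f)"
    and grad_indep: "\<And>z \<theta> S. card S = CARD('z) \<Longrightarrow>
          inj_on (\<lambda>j. gradient (\<lambda>w. f j w \<theta>) z) S \<and>
          independent ((\<lambda>j. gradient (\<lambda>w. f j w \<theta>) z) ` S)"
    and U_suitable: "program_optimal_solutions (bigM_coupling U) f \<mu> V =
          program_optimal_solutions indicator_coupling f \<mu> V"
    and flex_solvable: "\<exists>\<delta>. is_arg_max (\<lambda>\<delta>. \<delta>) (flexibility_feasible f \<mu> V) \<delta>"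
    and P_solvable: "program_optimal_solutions (bigM_coupling U) f \<mu> V \<noteq> {}"
    and delta_star: "\<delta>\<^sub>s = program_optimal_value (bigM_coupling U) f \<mu> V"
    and alpha_star: "\<alpha>\<^sub>s = chi_square_cdf CARD('n) \<delta>\<^sub>s"
    and prob: "prob_space M"
    and gaussian: "distributed M lborel X (\<lambda>\<theta>. ennreal (gaussian_density \<mu> V \<theta>))"
  shows "\<alpha>\<^sub>s = \<P>(\<omega> in M. X \<omega> \<in> T_ellip \<mu> V \<delta>\<^sub>s) \<and>
         \<alpha>\<^sub>s \<le> stochastic_flexibility f \<mu> V \<and>
         bij_betw (chi_square_cdf CARD('n)) {0..} {0..<1} \<and>
         \<delta>\<^sub>s = the_inv_into {0..} (chi_square_cdf CARD('n)) \<alpha>\<^sub>s"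
proof -
  let ?p = "gaussian_density \<mu> V" and ?T = "T_ellip \<mu> V \<delta>\<^sub>s"
  let ?\<Theta> = "{\<theta>. feasibility_fun f \<theta> \<le> 0}"
  interpret M: prob_space M by (rule prob)
  obtain x where x: "x \<in> program_optimal_solutions (bigM_coupling U) f \<mu> V"
    using P_solvable by blast
  then have xf: "x \<in> program_feasible (bigM_coupling U) f \<mu> V"
    and xm: "\<And>y. y \<in> program_feasible (bigM_coupling U) f \<mu> V \<Longrightarrow> fst x \<le> fst y"
    unfolding program_optimal_solutions_def is_arg_min_linorder mem_Collect_eq by blast+
  have "\<delta>\<^sub>s = fst x"
    unfolding delta_star program_optimal_value_def
    by (rule cInf_eq_minimum) (use xf xm in blast)+
  moreover have "0 \<le> fst x"
    using xf by (auto simp: program_feasible_def)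
  ultimately have \<delta>: "\<delta>\<^sub>s = fst x" "0 \<le> \<delta>\<^sub>s" by auto
  obtain \<delta>\<^sub>0 where "flexibility_feasible f \<mu> V \<delta>\<^sub>0"
    using flex_solvable by (auto simp: is_arg_max_def)
  \<comment> \<open>By \<open>U_suitable\<close> the solution \<open>x\<close> is also optimal under
    the implications, where the competitor built from a zero of \<open>\<psi>\<close> is
    admissible.\<close>
  with x have sub: "?T \<subseteq> ?\<Theta>"
    unfolding \<delta>(1) U_suitable
    by (intro feasibility_fun_nonpos_on_T_ellip[OF V_pos f_diff psi_attained psi_cont grad_indep])
  have [measurable]: "?p \<in> borel_measurable borel"
    unfolding gaussian_density_def by measurable
  have T_sets: "?T \<in> sets borel"
    by (intro borel_closed compact_imp_closed compact_T_ellip[OF V_pos])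
  have \<Theta>_sets: "?\<Theta> \<in> sets borel"
    by (intro borel_closed closed_Collect_le psi_cont continuous_intros)
  have total: "(\<integral>\<^sup>+\<theta>. ennreal (?p \<theta>) \<partial>lborel) = 1"
    using distributed_emeasure[OF gaussian, of UNIV] M.emeasure_space_1 by simp
  have "emeasure M (X -` ?T \<inter> space M) = ennreal \<alpha>\<^sub>s"
    using distributed_emeasure[OF gaussian, of ?T] T_sets gaussian_measure_T_ellip[OF V_pos total]
    by (simp add: alpha_star)
  moreover have \<alpha>: "0 \<le> \<alpha>\<^sub>s"
    using bij_betw_chi_square_cdf[of "CARD('n)"] \<delta>(2) by (auto simp: alpha_star bij_betw_def)
  ultimately have "measure M (X -` ?T \<inter> space M) = \<alpha>\<^sub>s" by (simp add: measure_def)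
  then have 1: "\<alpha>\<^sub>s = \<P>(\<omega> in M. X \<omega> \<in> ?T)"
    by (simp add: vimage_def Int_def conj_commute)
  \<comment> \<open>The sign is read off from the total mass: a negative radicand has a negative
    \<open>sqrt\<close>, hence a negative density.\<close>
  have "0 \<le> (2 * pi) ^ CARD('n) * det V"
  proof (rule ccontr)
    assume "\<not> 0 \<le> (2 * pi) ^ CARD('n) * det V"
    then have "?p \<theta> \<le> 0" for \<theta>
      by (simp add: gaussian_density_def divide_nonneg_neg)
    then show False using total by (simp add: ennreal_neg)
  qed
  then have p_nonneg: "0 \<le> ?p \<theta>" for \<theta> by (simp add: gaussian_density_def)
  \<comment> \<open>The ellipsoid lies in the feasible set, so its Gaussian mass is at most that of
    the feasible set.\<close>
  have "ennreal \<alpha>\<^sub>s \<le> (\<integral>\<^sup>+\<theta>. ennreal (?p \<theta>) * indicator ?\<Theta> \<theta> \<partial>lborel)"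
    unfolding alpha_star gaussian_measure_T_ellip[OF V_pos total, symmetric]
    using sub by (intro nn_integral_mono mult_left_mono) (auto simp: indicator_def)
  also have "\<dots> = (\<integral>\<^sup>+\<theta>. ennreal (indicator ?\<Theta> \<theta> *\<^sub>R ?p \<theta>) \<partial>lborel)"
    by (intro nn_integral_cong) (auto simp: indicator_def)
  also have "\<dots> = ennreal (stochastic_flexibility f \<mu> V)"
    unfolding stochastic_flexibility_def set_lebesgue_integral_def
  proof (rule nn_integral_eq_integral)
    have "integrable lborel ?p"
      using total p_nonneg by (intro integrableI_nonneg) auto
    then show "integrable lborel (\<lambda>\<theta>. indicator ?\<Theta> \<theta> *\<^sub>R ?p \<theta>)"
      using \<Theta>_sets by (intro integrable_mult_indicator) auto
  qed (use p_nonneg in auto)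
  finally have 2: "\<alpha>\<^sub>s \<le> stochastic_flexibility f \<mu> V"
    using p_nonneg by (subst (asm) ennreal_le_iff)
      (auto simp: stochastic_flexibility_def set_lebesgue_integral_def intro!: integral_nonneg_AE)
  have bij: "bij_betw (chi_square_cdf CARD('n)) {0..} {0..<1}"
    by (rule bij_betw_chi_square_cdf) simp
  then have "\<delta>\<^sub>s = the_inv_into {0..} (chi_square_cdf CARD('n)) \<alpha>\<^sub>s"
    using \<delta>(2) by (simp add: alpha_star the_inv_into_f_f bij_betw_def)
  with 1 2 bij show ?thesis by blast
qed

end
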